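(* There exist a continuum of Hopf algebra preduals for $\ell^1(\mathbb N,\cdot)$, where $(\mathbb N,\cdot)$ is the semigroup of positive integers under multiplication; that is, there is a family of cardinality $2^{\aleph_0}$ of pairwise distinct subspaces of $\ell^\infty(\mathbb N)$ each of which is a Hopf algebra predual of $\ell^1(\mathbb N,\cdot)$.
   Context: $\mathbb N=\{1,2,3,\dots\}$. For a semigroup $S$ (discrete), $\ell^1(S)$ is the complex convolution Banach algebra with standard unit vectors $(\delta_s)_{s\in S}$ and product determined by $\delta_s\delta_t=\delta_{st}$; its dual is identified with $\ell^\infty(S)$, with bimodule actions $(\delta_s\cdot f)(t)=f(ts)$ and $(f\cdot\delta_s)(t)=f(st)$. A predual of a Banach algebra $A$ is a norm-closed sub-bimodule $E\subseteq A^*$ which is a Banach space predual of $A$, i.e. the canonical map $A\to E^*$, $a\mapsto(\mu\mapsto\mu(a))$, is a linear isomorphism (bijective and bicontinuous, not necessarily isometric). A Hopf algebra predual of $\ell^1(S)$ is a predual $E\subseteq\ell^\infty(S)$ which is also a subalgebra of $\ell^\infty(S)$ for the pointwise product. *)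

theory Defs
  imports "HOL-Analysis.Analysis"
begin

section \<open>Norm topologies on spaces of complex functions\<close>

text \<open>All Banach spaces below are sets of complex-valued functions with pointwise
  operations: \<open>\<ell>\<^sup>1(S)\<close>, \<open>\<ell>\<^sup>\<infinity>(S)\<close>, and the dual of a subspace of \<open>\<ell>\<^sup>\<infinity>(S)\<close>.\<close>

definition csubspace :: "('i \<Rightarrow> complex) set \<Rightarrow> bool" where
  "csubspace V \<longleftrightarrow>
     (\<lambda>_. 0) \<in> V \<and>
     (\<forall>f\<in>V. \<forall>g\<in>V. (\<lambda>i. f i + g i) \<in> V) \<and>
     (\<forall>c. \<forall>f\<in>V. (\<lambda>i. c * f i) \<in> V)"

text \<open>The norms below are only meaningful on their spaces, whereas the locale
  \<open>Metric_space\<close> asks for nonnegativity and symmetry of the distance on the whole type;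
  hence the value \<open>0\<close> outside \<open>V\<close>.\<close>

definition norm_dist :: "('i \<Rightarrow> complex) set \<Rightarrow> (('i \<Rightarrow> complex) \<Rightarrow> real) \<Rightarrow>
    ('i \<Rightarrow> complex) \<Rightarrow> ('i \<Rightarrow> complex) \<Rightarrow> real" where
  "norm_dist V N f g = (if f \<in> V \<and> g \<in> V then N (\<lambda>i. f i - g i) else 0)"

definition norm_topology :: "('i \<Rightarrow> complex) set \<Rightarrow> (('i \<Rightarrow> complex) \<Rightarrow> real) \<Rightarrow>
    ('i \<Rightarrow> complex) topology" where
  "norm_topology V N = Metric_space.mtopology V (norm_dist V N)"


section \<open>The spaces \<open>\<ell>\<^sup>1(S)\<close> and \<open>\<ell>\<^sup>\<infinity>(S)\<close>\<close>

definition ell1 :: "('s \<Rightarrow> complex) set" where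
  "ell1 = {a. (\<lambda>s. norm (a s)) summable_on UNIV}"

definition ell1_norm :: "('s \<Rightarrow> complex) \<Rightarrow> real" where
  "ell1_norm a = (\<Sum>\<^sub>\<infinity>s. norm (a s))"

definition ell_inf :: "('s \<Rightarrow> complex) set" where
  "ell_inf = {f. bounded (range f)}"

definition ell_inf_norm :: "('s \<Rightarrow> complex) \<Rightarrow> real" where
  "ell_inf_norm f = (SUP s. norm (f s))"

definition pairing :: "('s \<Rightarrow> complex) \<Rightarrow> ('s \<Rightarrow> complex) \<Rightarrow> complex" where
  "pairing f a = (\<Sum>\<^sub>\<infinity>s. a s * f s)"

definition unit_vec :: "'s \<Rightarrow> 's \<Rightarrow> complex" where
  "unit_vec s = (\<lambda>t. if t = s then 1 else 0)"

text \<open>The actions of \<open>\<ell>\<^sup>1(S)\<close> on its dual \<open>\<ell>\<^sup>\<infinity>(S)\<close> are those extending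
  \<open>(\<delta>\<^sub>s \<cdot> f)(t) = f(ts)\<close> and \<open>(f \<cdot> \<delta>\<^sub>s)(t) = f(st)\<close> linearly and continuously in the
  \<open>\<ell>\<^sup>1\<close> variable; see the lemmas on unit vectors below.\<close>

definition left_act :: "('s::semigroup_mult \<Rightarrow> complex) \<Rightarrow> ('s \<Rightarrow> complex) \<Rightarrow> 's \<Rightarrow> complex" where
  "left_act a f = (\<lambda>t. \<Sum>\<^sub>\<infinity>s. a s * f (t * s))"

definition right_act :: "('s::semigroup_mult \<Rightarrow> complex) \<Rightarrow> ('s \<Rightarrow> complex) \<Rightarrow> 's \<Rightarrow> complex" where
  "right_act f a = (\<lambda>t. \<Sum>\<^sub>\<infinity>s. a s * f (s * t))"


section \<open>Preduals\<close>

definition closed_sub_bimodule :: "('s::semigroup_mult \<Rightarrow> complex) set \<Rightarrow> bool" where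
  "closed_sub_bimodule E \<longleftrightarrow>
     csubspace E \<and>
     closedin (norm_topology ell_inf ell_inf_norm) E \<and>
     (\<forall>a\<in>ell1. \<forall>f\<in>E. left_act a f \<in> E \<and> right_act f a \<in> E)"

text \<open>A functional on \<open>E\<close> is represented by its extension by \<open>0\<close> to the ambient function
  type, so that distinct members of \<open>dual_space E\<close> are distinct on \<open>E\<close>.\<close>

definition dual_space :: "('s \<Rightarrow> complex) set \<Rightarrow> (('s \<Rightarrow> complex) \<Rightarrow> complex) set" where
  "dual_space E = {\<phi>.
     (\<forall>f. f \<notin> E \<longrightarrow> \<phi> f = 0) \<and>
     (\<forall>f\<in>E. \<forall>g\<in>E. \<phi> (\<lambda>s. f s + g s) = \<phi> f + \<phi> g) \<and>
     (\<forall>c. \<forall>f\<in>E. \<phi> (\<lambda>s. c * f s) = c * \<phi> f) \<and>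
     (\<exists>C. \<forall>f\<in>E. norm (\<phi> f) \<le> C * ell_inf_norm f)}"

definition dual_norm :: "('s \<Rightarrow> complex) set \<Rightarrow> (('s \<Rightarrow> complex) \<Rightarrow> complex) \<Rightarrow> real" where
  "dual_norm E \<phi> = (SUP f\<in>{f\<in>E. ell_inf_norm f \<le> 1}. norm (\<phi> f))"

definition canonical_map :: "('s \<Rightarrow> complex) set \<Rightarrow> ('s \<Rightarrow> complex) \<Rightarrow> ('s \<Rightarrow> complex) \<Rightarrow> complex" where
  "canonical_map E a = (\<lambda>\<mu>. if \<mu> \<in> E then pairing \<mu> a else 0)"

text \<open>The canonical map is always linear (lemmas \<open>canonical_map_add\<close> and
  \<open>canonical_map_scale\<close>), so being a linear isomorphism of Banach spaces means being a
  homeomorphism of \<open>\<ell>\<^sup>1(S)\<close> onto the dual of \<open>E\<close> for the norm topologies.\<close>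

definition predual :: "('s::semigroup_mult \<Rightarrow> complex) set \<Rightarrow> bool" where
  "predual E \<longleftrightarrow>
     closed_sub_bimodule E \<and>
     homeomorphic_map (norm_topology ell1 ell1_norm)
       (norm_topology (dual_space E) (dual_norm E)) (canonical_map E)"

text \<open>A subalgebra need not contain the constant function \<open>1\<close>, so that for instance
  \<open>c\<^sub>0(\<nat>)\<close> qualifies for \<open>(\<nat>, \<cdot>)\<close>.\<close>

definition hopf_algebra_predual :: "('s::semigroup_mult \<Rightarrow> complex) set \<Rightarrow> bool" where
  "hopf_algebra_predual E \<longleftrightarrow>
     predual E \<and> (\<forall>f\<in>E. \<forall>g\<in>E. (\<lambda>s. f s * g s) \<in> E)"


section \<open>The multiplicative semigroup of positive integers\<close>

typedef pnat = "{n::nat. 0 < n}"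
  morphisms nat_of_pnat pnat_of_nat
  by auto

setup_lifting type_definition_pnat

instantiation pnat :: comm_monoid_mult
begin

lift_definition one_pnat :: pnat is 1
  by simp

lift_definition times_pnat :: "pnat \<Rightarrow> pnat \<Rightarrow> pnat" is "(*)"
  by simp

instance
  by standard (transfer; simp add: mult.assoc mult.commute)+

end


section \<open>Basic facts\<close>

lemma left_act_unit_vec: "left_act (unit_vec s) f t = f (t * s)"
proof -
  have "left_act (unit_vec s) f t = (\<Sum>\<^sub>\<infinity>u\<in>{s}. unit_vec s u * f (t * u))"
    unfolding left_act_def by (rule infsum_cong_neutral) (auto simp: unit_vec_def)
  then show ?thesis by (simp add: unit_vec_def)
qed

lemma right_act_unit_vec: "right_act f (unit_vec s) t = f (s * t)"
proof -
  have "right_act f (unit_vec s) t = (\<Sum>\<^sub>\<infinity>u\<in>{s}. unit_vec s u * f (u * t))"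
    unfolding right_act_def by (rule infsum_cong_neutral) (auto simp: unit_vec_def)
  then show ?thesis by (simp add: unit_vec_def)
qed

lemma pairing_summable:
  assumes "a \<in> ell1" "f \<in> ell_inf"
  shows "(\<lambda>s. a s * f s) summable_on UNIV"
proof -
  obtain C where C: "\<And>s. norm (f s) \<le> C"
    using assms(2) by (auto simp: ell_inf_def bounded_iff)
  have "(\<lambda>s. norm (a s) * C) summable_on UNIV"
    using assms(1) by (intro summable_on_cmult_left) (simp add: ell1_def)
  then have "(\<lambda>s. norm (a s * f s)) summable_on UNIV"
    by (rule summable_on_comparison_test) (auto simp: norm_mult intro!: mult_left_mono C)
  then show ?thesis by (rule abs_summable_summable)
qed

lemma canonical_map_add:
  assumes "E \<subseteq> ell_inf" "a \<in> ell1" "b \<in> ell1"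
  shows "canonical_map E (\<lambda>s. a s + b s) = (\<lambda>\<mu>. canonical_map E a \<mu> + canonical_map E b \<mu>)"
proof
  fix \<mu>
  show "canonical_map E (\<lambda>s. a s + b s) \<mu> = canonical_map E a \<mu> + canonical_map E b \<mu>"
  proof (cases "\<mu> \<in> E")
    case True
    then have "\<mu> \<in> ell_inf" using assms(1) by blast
    then show ?thesis
      using infsum_add[OF pairing_summable[OF assms(2)] pairing_summable[OF assms(3)]]
      by (simp add: canonical_map_def pairing_def distrib_right)
  qed (simp add: canonical_map_def)
qed

lemma canonical_map_scale:
  "canonical_map E (\<lambda>s. c * a s) = (\<lambda>\<mu>. c * canonical_map E a \<mu>)"
  by (auto simp: canonical_map_def pairing_def mult.assoc infsum_cmult_right')

lemma Metric_space_norm_dist: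
  assumes sub: "csubspace V"
    and nonneg: "\<And>f. f \<in> V \<Longrightarrow> 0 \<le> N f"
    and zero: "\<And>f. f \<in> V \<Longrightarrow> N f = 0 \<longleftrightarrow> f = (\<lambda>_. 0)"
    and minus: "\<And>f. f \<in> V \<Longrightarrow> N (\<lambda>i. - f i) = N f"
    and triangle: "\<And>f g. f \<in> V \<Longrightarrow> g \<in> V \<Longrightarrow> N (\<lambda>i. f i + g i) \<le> N f + N g"
  shows "Metric_space V (norm_dist V N)"
proof -
  have diff: "(\<lambda>i. f i - g i) \<in> V" if "f \<in> V" "g \<in> V" for f g
  proof -
    have add: "\<forall>f\<in>V. \<forall>g\<in>V. (\<lambda>i. f i + g i) \<in> V"
      and scale: "\<forall>c. \<forall>f\<in>V. (\<lambda>i. c * f i) \<in> V"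
      using sub by (simp_all add: csubspace_def)
    have "(\<lambda>i. (-1) * g i) \<in> V"
      using scale that(2) by blast
    then show ?thesis
      using bspec[OF bspec[OF add that(1)], of "\<lambda>i. (-1) * g i"] by simp
  qed
  show ?thesis
  proof
    fix f g
    show "0 \<le> norm_dist V N f g"
      by (auto simp: norm_dist_def intro: nonneg diff)
    show "norm_dist V N f g = norm_dist V N g f"
      using minus[OF diff, of f g] by (auto simp: norm_dist_def)
  next
    fix f g assume "f \<in> V" "g \<in> V"
    then show "norm_dist V N f g = 0 \<longleftrightarrow> f = g"
      using zero[OF diff, of f g] by (auto simp: norm_dist_def fun_eq_iff)
  next
    fix f g h assume "f \<in> V" "g \<in> V" "h \<in> V"
    then show "norm_dist V N f h \<le> norm_dist V N f g + norm_dist V N g h"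
      using triangle[OF diff diff, of f g g h] by (simp add: norm_dist_def)
  qed
qed

lemma ell_inf_norm_upper: "f \<in> ell_inf \<Longrightarrow> norm (f s) \<le> ell_inf_norm f"
  unfolding ell_inf_def ell_inf_norm_def
  by (intro cSUP_upper) (auto simp: bounded_iff bdd_above_def)

lemma ell_inf_norm_least: "(\<And>s. norm (f s) \<le> C) \<Longrightarrow> ell_inf_norm f \<le> C"
  unfolding ell_inf_norm_def by (intro cSUP_least) auto

lemma ell_inf_norm_nonneg: "f \<in> ell_inf \<Longrightarrow> 0 \<le> ell_inf_norm f"
  using ell_inf_norm_upper[of f undefined] norm_ge_zero order_trans by blast

lemma ell_infI: "(\<And>s. norm (f s) \<le> C) \<Longrightarrow> f \<in> ell_inf"
  unfolding ell_inf_def bounded_iff by blast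

lemma csubspace_ell_inf: "csubspace ell_inf"
  unfolding csubspace_def
proof (intro conjI ballI allI)
  show "(\<lambda>_. 0) \<in> ell_inf" by (rule ell_infI[of _ 0]) simp
next
  fix f g :: "'a \<Rightarrow> complex" assume "f \<in> ell_inf" "g \<in> ell_inf"
  then show "(\<lambda>i. f i + g i) \<in> ell_inf"
    by (intro ell_infI[of "\<lambda>i. f i + g i" "ell_inf_norm f + ell_inf_norm g"]
        norm_triangle_mono ell_inf_norm_upper)
next
  fix c and f :: "'a \<Rightarrow> complex" assume "f \<in> ell_inf"
  then show "(\<lambda>i. c * f i) \<in> ell_inf"
    by (intro ell_infI[of _ "norm c * ell_inf_norm f"])
       (auto simp: norm_mult intro!: mult_left_mono ell_inf_norm_upper)
qed

lemma Metric_space_ell_inf: "Metric_space ell_inf (norm_dist ell_inf ell_inf_norm)"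
proof (rule Metric_space_norm_dist[OF csubspace_ell_inf])
  fix f :: "'a \<Rightarrow> complex" assume f: "f \<in> ell_inf"
  show "0 \<le> ell_inf_norm f" by (rule ell_inf_norm_nonneg[OF f])
  show "ell_inf_norm f = 0 \<longleftrightarrow> f = (\<lambda>_. 0)"
  proof
    assume "ell_inf_norm f = 0"
    then have "norm (f s) \<le> 0" for s using ell_inf_norm_upper[OF f, of s] by simp
    then show "f = (\<lambda>_. 0)" by auto
  qed (simp add: ell_inf_norm_def)
  show "ell_inf_norm (\<lambda>i. - f i) = ell_inf_norm f" by (simp add: ell_inf_norm_def)
next
  fix f g :: "'a \<Rightarrow> complex" assume "f \<in> ell_inf" "g \<in> ell_inf"
  then show "ell_inf_norm (\<lambda>i. f i + g i) \<le> ell_inf_norm f + ell_inf_norm g"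
    by (intro ell_inf_norm_least norm_triangle_mono ell_inf_norm_upper)
qed

lemma csubspace_ell1: "csubspace ell1"
  unfolding csubspace_def
proof (intro conjI ballI allI)
  show "(\<lambda>_. 0) \<in> ell1" by (simp add: ell1_def)
next
  fix f g :: "'a \<Rightarrow> complex" assume "f \<in> ell1" "g \<in> ell1"
  then have "(\<lambda>i. norm (f i) + norm (g i)) summable_on UNIV"
    by (simp add: ell1_def summable_on_add)
  then have "(\<lambda>i. norm (f i + g i)) summable_on UNIV"
    by (rule summable_on_comparison_test) (simp_all add: norm_triangle_ineq)
  then show "(\<lambda>i. f i + g i) \<in> ell1" by (simp add: ell1_def)
next
  fix c and f :: "'a \<Rightarrow> complex" assume "f \<in> ell1"
  then show "(\<lambda>i. c * f i) \<in> ell1"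
    by (simp add: ell1_def norm_mult summable_on_cmult_right)
qed

lemma Metric_space_ell1: "Metric_space ell1 (norm_dist ell1 ell1_norm)"
proof (rule Metric_space_norm_dist[OF csubspace_ell1])
  fix f :: "'a \<Rightarrow> complex" assume f: "f \<in> ell1"
  show "0 \<le> ell1_norm f" by (simp add: ell1_norm_def infsum_nonneg)
  show "ell1_norm f = 0 \<longleftrightarrow> f = (\<lambda>_. 0)"
  proof
    assume "ell1_norm f = 0"
    then have "norm (f s) = 0" for s
      using f by (intro nonneg_infsum_le_0D[of "\<lambda>s. norm (f s)" UNIV])
                 (auto simp: ell1_def ell1_norm_def)
    then show "f = (\<lambda>_. 0)" by auto
  qed (simp add: ell1_norm_def)
  show "ell1_norm (\<lambda>i. - f i) = ell1_norm f" by (simp add: ell1_norm_def)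
next
  fix f g :: "'a \<Rightarrow> complex" assume fg: "f \<in> ell1" "g \<in> ell1"
  then have "(\<lambda>i. f i + g i) \<in> ell1"
    using csubspace_ell1 unfolding csubspace_def by blast
  with fg show "ell1_norm (\<lambda>i. f i + g i) \<le> ell1_norm f + ell1_norm g"
    unfolding ell1_norm_def ell1_def
    by (subst infsum_add[symmetric])
       (auto intro!: infsum_mono summable_on_add norm_triangle_ineq)
qed

lemma dual_norm_upper:
  assumes E: "csubspace E" "E \<subseteq> ell_inf" and \<phi>: "\<phi> \<in> dual_space E" and f: "f \<in> E"
  shows "norm (\<phi> f) \<le> dual_norm E \<phi> * ell_inf_norm f"
proof -
  obtain C where C: "\<And>f. f \<in> E \<Longrightarrow> norm (\<phi> f) \<le> C * ell_inf_norm f"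
    using \<phi> unfolding dual_space_def by blast
  have scale: "\<phi> (\<lambda>s. c * f s) = c * \<phi> f" for c
    using \<phi> f unfolding dual_space_def by blast
  have fi: "f \<in> ell_inf" using E f by blast
  have bdd: "bdd_above ((\<lambda>f. norm (\<phi> f)) ` {f \<in> E. ell_inf_norm f \<le> 1})"
  proof (rule bdd_aboveI2)
    fix g assume g: "g \<in> {f \<in> E. ell_inf_norm f \<le> 1}"
    then have "0 \<le> ell_inf_norm g" using E(2) ell_inf_norm_nonneg by blast
    then have "C * ell_inf_norm g \<le> \<bar>C\<bar> * 1"
      using g by (intro mult_mono) auto
    then show "norm (\<phi> g) \<le> \<bar>C\<bar> * 1" using C[of g] g by auto
  qed
  show ?thesis
  proof (cases "ell_inf_norm f = 0")
    case True
    then show ?thesis using C[OF f] by simp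
  next
    case False
    define r where "r = ell_inf_norm f"
    have r: "r > 0" using False ell_inf_norm_nonneg[OF fi] by (simp add: r_def)
    let ?g = "\<lambda>s. complex_of_real (1 / r) * f s"
    have "?g \<in> E" using E(1) f unfolding csubspace_def by blast
    moreover have "ell_inf_norm ?g \<le> 1"
      using r ell_inf_norm_upper[OF fi]
      by (intro ell_inf_norm_least) (simp add: norm_mult norm_divide r_def)
    ultimately have "norm (\<phi> ?g) \<le> dual_norm E \<phi>"
      unfolding dual_norm_def by (intro cSUP_upper[OF _ bdd]) auto
    then show ?thesis
      using r unfolding scale by (simp add: norm_mult norm_divide field_simps flip: r_def)
  qed
qed

lemma dual_norm_least:
  assumes "csubspace E" "\<And>f. f \<in> E \<Longrightarrow> ell_inf_norm f \<le> 1 \<Longrightarrow> norm (\<phi> f) \<le> C"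
  shows "dual_norm E \<phi> \<le> C"
  unfolding dual_norm_def
proof (rule cSUP_least)
  have "(\<lambda>_. 0) \<in> {f \<in> E. ell_inf_norm f \<le> 1}"
    using assms(1) by (auto simp: csubspace_def ell_inf_norm_def)
  then show "{f \<in> E. ell_inf_norm f \<le> 1} \<noteq> {}" by blast
qed (use assms(2) in auto)

lemma csubspace_dual_space:
  assumes E: "csubspace E" "E \<subseteq> ell_inf"
  shows "csubspace (dual_space E)"
  unfolding csubspace_def
proof (intro conjI ballI allI)
  show "(\<lambda>_. 0) \<in> dual_space E" by (auto simp: dual_space_def intro!: exI[of _ 0])
next
  fix \<phi> \<psi> assume *: "\<phi> \<in> dual_space E" "\<psi> \<in> dual_space E"
  have "norm (\<phi> f + \<psi> f) \<le> (dual_norm E \<phi> + dual_norm E \<psi>) * ell_inf_norm f" if "f \<in> E" for f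
    using norm_triangle_mono[OF dual_norm_upper[OF E *(1) that] dual_norm_upper[OF E *(2) that]]
    by (simp add: distrib_right)
  with * show "(\<lambda>f. \<phi> f + \<psi> f) \<in> dual_space E"
    unfolding dual_space_def by (simp add: distrib_left) blast
next
  fix c \<phi> assume *: "\<phi> \<in> dual_space E"
  have "norm (c * \<phi> f) \<le> (norm c * dual_norm E \<phi>) * ell_inf_norm f" if "f \<in> E" for f
    using mult_left_mono[OF dual_norm_upper[OF E * that] norm_ge_zero[of c]]
    by (simp add: norm_mult mult.assoc)
  with * show "(\<lambda>f. c * \<phi> f) \<in> dual_space E"
    unfolding dual_space_def by (simp add: distrib_left mult.left_commute) blast
qed

lemma dual_norm_nonneg:
  assumes E: "csubspace E" "E \<subseteq> ell_inf" and \<phi>: "\<phi> \<in> dual_space E"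
  shows "0 \<le> dual_norm E \<phi>"
proof (rule ccontr)
  assume neg: "\<not> 0 \<le> dual_norm E \<phi>"
  have z: "\<phi> f = 0" if f: "f \<in> E" for f
  proof -
    have "dual_norm E \<phi> * ell_inf_norm f \<le> 0"
      using neg ell_inf_norm_nonneg[of f] E(2) f by (intro mult_nonpos_nonneg) auto
    then have "norm (\<phi> f) \<le> 0" using dual_norm_upper[OF E \<phi> f] by linarith
    then show ?thesis by simp
  qed
  have "dual_norm E \<phi> = (SUP f\<in>{f\<in>E. ell_inf_norm f \<le> 1}. 0)"
    unfolding dual_norm_def by (intro SUP_cong) (auto simp: z)
  moreover have "(\<lambda>_. 0) \<in> {f\<in>E. ell_inf_norm f \<le> 1}"
    using E(1) by (simp add: csubspace_def ell_inf_norm_def)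
  then have "{f\<in>E. ell_inf_norm f \<le> 1} \<noteq> {}" by blast
  ultimately show False using neg by simp
qed

lemma Metric_space_dual_space:
  assumes E: "csubspace E" "E \<subseteq> ell_inf"
  shows "Metric_space (dual_space E) (norm_dist (dual_space E) (dual_norm E))"
proof (rule Metric_space_norm_dist[OF csubspace_dual_space[OF E]])
  fix \<phi> assume \<phi>: "\<phi> \<in> dual_space E"
  show nonneg: "0 \<le> dual_norm E \<phi>" by (rule dual_norm_nonneg[OF E \<phi>])
  show "dual_norm E \<phi> = 0 \<longleftrightarrow> \<phi> = (\<lambda>_. 0)"
  proof
    assume "dual_norm E \<phi> = 0"
    then have "\<phi> f = 0" if "f \<in> E" for f using dual_norm_upper[OF E \<phi> that] by simp
    moreover have "\<phi> f = 0" if "f \<notin> E" for f using \<phi> that by (auto simp: dual_space_def)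
    ultimately show "\<phi> = (\<lambda>_. 0)" by blast
  next
    assume "\<phi> = (\<lambda>_. 0)"
    then have "dual_norm E \<phi> \<le> 0" by (intro dual_norm_least[OF E(1)]) simp
    then show "dual_norm E \<phi> = 0" using nonneg by simp
  qed
  show "dual_norm E (\<lambda>f. - \<phi> f) = dual_norm E \<phi>" by (simp add: dual_norm_def)
next
  fix \<phi> \<psi> assume *: "\<phi> \<in> dual_space E" "\<psi> \<in> dual_space E"
  show "dual_norm E (\<lambda>f. \<phi> f + \<psi> f) \<le> dual_norm E \<phi> + dual_norm E \<psi>"
  proof (rule dual_norm_least[OF E(1)])
    fix f assume f: "f \<in> E" "ell_inf_norm f \<le> 1"
    have "norm (\<theta> f) \<le> dual_norm E \<theta>" if "\<theta> \<in> dual_space E" for \<theta>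
      using dual_norm_upper[OF E that f(1)]
        mult_left_mono[OF f(2) dual_norm_nonneg[OF E that]] by linarith
    with * show "norm (\<phi> f + \<psi> f) \<le> dual_norm E \<phi> + dual_norm E \<psi>"
      by (intro norm_triangle_mono) auto
  qed
qed

end

(* Let every prime p >= 5 have a limit l(p) in {2, 3}, and topologise the set of primes so that
   2 and 3 are the only possible limit points, a set of primes with the same l clustering only at
   that l. The free commutative monoid on this compact space is a locally compact topology on the
   positive integers for which translations are continuous and proper, so C_0 of it is a closed
   sub-bimodule and a subalgebra. Being countable, the space carries only discrete measures, so the
   dual of C_0 is isometrically l^1.

   Concretely the topology is that of an inverse limit: let h_N be the completely multiplicative
   retraction that fixes the primes p < N and the primes 2, 3, and maps every other p to l(p).
   A functional on C_0 determines masses as cluster points of its values on the indicators of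
   {h_N = m}, and what remains has no atoms. It vanishes by induction on the rank, which is the
   number of prime factors 2 and 3 of a point: h_N strictly increases it wherever it is not the
   identity.

   Colour the primes so that each of infinitely many colours occurs infinitely often. The sets A of
   colours give different spaces, l(p) being 2 exactly when the colour of p is in A. *)
theory Submission
  imports Defs "HOL-Computational_Algebra.Primes"
begin

section \<open>The duality between \<open>\<ell>\<^sup>1\<close> and \<open>\<ell>\<^sup>\<infinity>\<close>\<close>

lemma mult_cnj_sgn: "z * cnj (sgn z) = complex_of_real (norm z)"
  by (cases "z = 0") (auto simp: sgn_eq complex_norm_square[symmetric] power2_eq_square)

text \<open>The set \<open>F\<close> is meant to be finite and to carry all but a small part of the
  mass of \<open>a\<close>, so that only the tail of \<open>a\<close> enters the bound. With
  \<open>F\<close> empty this is the usual estimate by the two norms.\<close>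

lemma norm_pairing_le:
  assumes a: "a \<in> ell1" and F: "\<And>s. s \<in> F \<Longrightarrow> f s = 0" and C: "\<And>s. norm (f s) \<le> C"
  shows "norm (pairing f a) \<le> C * (\<Sum>\<^sub>\<infinity>s\<in>-F. norm (a s))"
proof -
  have sa: "(\<lambda>s. norm (a s)) summable_on -F"
    using a by (auto simp: ell1_def intro: summable_on_subset_banach)
  have "(\<lambda>s. a s * f s) summable_on -F"
    by (rule summable_on_subset_banach[OF pairing_summable[OF a ell_infI[OF C]]]) simp
  then have "norm (\<Sum>\<^sub>\<infinity>s\<in>-F. a s * f s) \<le> (\<Sum>\<^sub>\<infinity>s\<in>-F. C * norm (a s))"
    using sa C by (intro norm_infsum_le[OF has_sum_infsum has_sum_infsum] summable_on_cmult_right)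
      (auto simp: norm_mult mult.commute[of C] intro!: mult_left_mono)
  also have "(\<Sum>\<^sub>\<infinity>s\<in>-F. a s * f s) = pairing f a"
    unfolding pairing_def by (rule infsum_cong_neutral) (auto simp: F)
  finally show ?thesis
    by (simp add: infsum_cmult_right')
qed

lemma norm_pairing_le_ell1_norm:
  assumes "a \<in> ell1" "\<And>s. norm (f s) \<le> C"
  shows "norm (pairing f a) \<le> C * ell1_norm a"
  using norm_pairing_le[of a "{}" f C] assms by (simp add: ell1_norm_def)

lemma ell1_small_tail:
  assumes "a \<in> ell1" "e > 0"
  obtains F where "finite F" "(\<Sum>\<^sub>\<infinity>s\<in>-F. norm (a s)) \<le> e"
proof -
  have s: "(\<lambda>s. norm (a s)) summable_on UNIV"
    using assms by (simp add: ell1_def)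
  from infsum_finite_approximation[OF s assms(2)]
  obtain F where F: "finite F" "dist (\<Sum>s\<in>F. norm (a s)) (\<Sum>\<^sub>\<infinity>s. norm (a s)) \<le> e"
    by blast
  have "(\<Sum>\<^sub>\<infinity>s. norm (a s)) = (\<Sum>s\<in>F. norm (a s)) + (\<Sum>\<^sub>\<infinity>s\<in>-F. norm (a s))"
    using infsum_Un_disjoint[of "\<lambda>s. norm (a s)" F "-F"] F(1) summable_on_subset_banach[OF s]
    by simp
  then show thesis
    using F by (intro that[of F]) (auto simp: dist_real_def)
qed

lemma pairing_add:
  assumes "a \<in> ell1" "f \<in> ell_inf" "g \<in> ell_inf"
  shows "pairing (\<lambda>s. f s + g s) a = pairing f a + pairing g a"
  using infsum_add[OF pairing_summable[OF assms(1,2)] pairing_summable[OF assms(1,3)]]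
  by (simp add: pairing_def distrib_left)

lemma pairing_scale: "pairing (\<lambda>s. c * f s) a = c * pairing f a"
  by (simp add: pairing_def mult.left_commute infsum_cmult_right')

lemma pairing_diff:
  assumes "a \<in> ell1" "f \<in> ell_inf" "g \<in> ell_inf"
  shows "pairing (\<lambda>s. f s - g s) a = pairing f a - pairing g a"
proof -
  have "(\<lambda>s. -1 * g s) \<in> ell_inf"
    using csubspace_ell_inf assms(3) unfolding csubspace_def by blast
  from pairing_add[OF assms(1,2) this] show ?thesis
    using pairing_scale[of "-1" g a] by simp
qed

lemma pairing_finite_support:
  assumes "finite F" "\<And>s. s \<notin> F \<Longrightarrow> f s = 0"
  shows "pairing f a = (\<Sum>s\<in>F. a s * f s)"
proof -
  have "pairing f a = (\<Sum>\<^sub>\<infinity>s\<in>F. a s * f s)"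
    unfolding pairing_def by (rule infsum_cong_neutral) (auto simp: assms)
  then show ?thesis using assms(1) by simp
qed

lemma pairing_unit_vec: "pairing (unit_vec m) a = a m"
  using pairing_finite_support[of "{m}" "unit_vec m" a] by (simp add: unit_vec_def)

lemma canonical_map_in_dual_space:
  assumes "csubspace E" "E \<subseteq> ell_inf" "a \<in> ell1"
  shows "canonical_map E a \<in> dual_space E"
proof -
  have "norm (pairing f a) \<le> ell1_norm a * ell_inf_norm f" if "f \<in> E" for f
    using norm_pairing_le_ell1_norm[OF assms(3), of f "ell_inf_norm f"] ell_inf_norm_upper[of f] that assms(2)
    by (simp add: mult.commute subset_iff)
  then show ?thesis
    using assms(1) pairing_add[OF assms(3)] assms(2)
    by (auto simp: dual_space_def canonical_map_def csubspace_def pairing_scale subset_iff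
        intro!: exI[of _ "ell1_norm a"])
qed

section \<open>Finite linear combinations in subspaces and under functionals\<close>

lemma csubspace_diff:
  assumes "csubspace V" "f \<in> V" "g \<in> V"
  shows "(\<lambda>s. f s - g s) \<in> V"
proof -
  have add: "\<And>f g. f \<in> V \<Longrightarrow> g \<in> V \<Longrightarrow> (\<lambda>s. f s + g s) \<in> V"
    and scale: "\<And>c f. f \<in> V \<Longrightarrow> (\<lambda>s. c * f s) \<in> V"
    using assms(1) unfolding csubspace_def by blast+
  show ?thesis
    using add[OF assms(2) scale[OF assms(3), of "-1"]] by simp
qed

lemma csubspace_sum:
  assumes "csubspace V" "finite F" "\<And>i. i \<in> F \<Longrightarrow> f i \<in> V"
  shows "(\<lambda>s. \<Sum>i\<in>F. c i * f i s) \<in> V"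
  using assms(2,3)
proof (induction F)
  case empty
  then show ?case using assms(1) by (simp add: csubspace_def)
next
  case (insert x F)
  then have "(\<lambda>s. c x * f x s) \<in> V" "(\<lambda>s. \<Sum>i\<in>F. c i * f i s) \<in> V"
    using assms(1) by (auto simp: csubspace_def)
  then show ?case using insert.hyps assms(1) by (simp add: csubspace_def)
qed

lemma dual_space_sum:
  assumes "csubspace E" "\<phi> \<in> dual_space E" "finite F" "\<And>i. i \<in> F \<Longrightarrow> f i \<in> E"
  shows "\<phi> (\<lambda>s. \<Sum>i\<in>F. c i * f i s) = (\<Sum>i\<in>F. c i * \<phi> (f i))"
  using assms(3,4)
proof (induction F)
  case empty
  have *: "(\<lambda>_. 0) \<in> E" using assms(1) by (simp add: csubspace_def)
  have "\<And>c f. f \<in> E \<Longrightarrow> \<phi> (\<lambda>s. c * f s) = c * \<phi> f"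
    using assms(2) unfolding dual_space_def by blast
  from this[OF *, of 0] show ?case by simp
next
  case (insert x F)
  have "(\<lambda>s. c x * f x s) \<in> E" "(\<lambda>s. \<Sum>i\<in>F. c i * f i s) \<in> E"
    using assms(1) csubspace_sum[OF assms(1), of F f c] insert by (auto simp: csubspace_def)
  moreover have "\<phi> (\<lambda>s. c x * f x s) = c x * \<phi> (f x)"
    using assms(2) insert.prems unfolding dual_space_def by blast
  ultimately have "\<phi> (\<lambda>s. c x * f x s + (\<Sum>i\<in>F. c i * f i s)) = c x * \<phi> (f x) + (\<Sum>i\<in>F. c i * \<phi> (f i))"
    using assms(2) insert unfolding dual_space_def by simp
  then show ?case using insert.hyps by simp
qed

lemma dual_space_diff:
  assumes "csubspace E" "\<phi> \<in> dual_space E" "f \<in> E" "g \<in> E"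
  shows "\<phi> (\<lambda>s. f s - g s) = \<phi> f - \<phi> g"
  using dual_space_sum[OF assms(1,2), of "{True,False}" "\<lambda>b. if b then f else g" "\<lambda>b. if b then 1 else -1"]
    assms(3,4) by simp

text \<open>The inequality converse to \<open>isom\<close> holds for every \<open>E\<close>, so
  \<open>isom\<close> makes the canonical map an isometry and in particular injective. A surjective
  isometry is a homeomorphism.\<close>

lemma predualI_isometric:
  assumes E: "closed_sub_bimodule E" "E \<subseteq> ell_inf"
    and isom: "\<And>a. a \<in> ell1 \<Longrightarrow> ell1_norm a \<le> dual_norm E (canonical_map E a)"
    and surj: "\<And>\<phi>. \<phi> \<in> dual_space E \<Longrightarrow> \<exists>a\<in>ell1. \<forall>f\<in>E. \<phi> f = pairing f a"
  shows "predual E"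
proof -
  have sub: "csubspace E" using E(1) by (simp add: closed_sub_bimodule_def)
  note can = canonical_map_in_dual_space[OF sub E(2)]
  have norm_eq: "dual_norm E (canonical_map E a) = ell1_norm a" if a: "a \<in> ell1" for a
  proof (rule antisym[OF dual_norm_least[OF sub] isom[OF a]])
    fix f assume f: "f \<in> E" "ell_inf_norm f \<le> 1"
    then have "norm (f s) \<le> 1" for s
      using ell_inf_norm_upper[of f s] E(2) by auto
    from norm_pairing_le_ell1_norm[OF a this]
    show "norm (canonical_map E a f) \<le> ell1_norm a"
      using f by (simp add: canonical_map_def)
  qed
  interpret Metric_space12 ell1 "norm_dist ell1 ell1_norm"
    "dual_space E" "norm_dist (dual_space E) (dual_norm E)"
    by (intro Metric_space12.intro Metric_space_ell1 Metric_space_dual_space sub E)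
  have "homeomorphic_map M1.mtopology M2.mtopology (canonical_map E)"
  proof (rule isometry_imp_homeomorphic_map)
    show "canonical_map E ` ell1 = dual_space E"
    proof
      show "dual_space E \<subseteq> canonical_map E ` ell1"
      proof
        fix \<phi> assume \<phi>: "\<phi> \<in> dual_space E"
        with surj obtain a where a: "a \<in> ell1" "\<forall>f\<in>E. \<phi> f = pairing f a" by blast
        have "\<phi> = canonical_map E a"
          using a \<phi> by (auto simp: canonical_map_def dual_space_def)
        with a show "\<phi> \<in> canonical_map E ` ell1" by blast
      qed
    qed (use can in blast)
    fix a b :: "'a \<Rightarrow> complex" assume ab: "a \<in> ell1" "b \<in> ell1"
    have d: "(\<lambda>s. a s - b s) \<in> ell1" by (rule csubspace_diff[OF csubspace_ell1 ab])
    have "canonical_map E (\<lambda>s. a s - b s) = (\<lambda>\<mu>. canonical_map E a \<mu> - canonical_map E b \<mu>)"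
      using canonical_map_add[OF E(2) d ab(2)] by (simp add: fun_eq_iff)
    with norm_eq[OF d] show "norm_dist (dual_space E) (dual_norm E) (canonical_map E a) (canonical_map E b)
        = norm_dist ell1 ell1_norm a b"
      using ab can by (simp add: norm_dist_def)
  qed
  then show ?thesis
    using E(1) by (simp add: predual_def norm_topology_def)
qed

section \<open>The function space of a sequence of retractions\<close>

text \<open>For the retractions below this is \<open>C\<^sub>0\<close> of the initial topology of the maps
  \<open>h N\<close> into discrete spaces. The second condition says that \<open>f\<close> is in \<open>c\<^sub>0\<close> on the range of every
  \<open>h N\<close>.\<close>

definition retract_space :: "(nat \<Rightarrow> 's \<Rightarrow> 's) \<Rightarrow> ('s \<Rightarrow> complex) set" where
  "retract_space h = {f \<in> ell_inf. uniform_limit UNIV (\<lambda>N s. f (h N s)) f sequentially \<and>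
     (\<forall>N. (f \<longlongrightarrow> 0) (inf cofinite (principal {s. h N s = s})))}"

section \<open>Algebra structure, norm closedness and truncation\<close>

lemma retract_space_subset: "retract_space h \<subseteq> ell_inf"
  by (auto simp: retract_space_def)

lemma bounded_of_ell_inf: "f \<in> ell_inf \<Longrightarrow> bounded (f ` S)"
  using bounded_subset[of "range f" "f ` S"] by (auto simp: ell_inf_def)

lemma csubspace_retract_space: "csubspace (retract_space h)"
  unfolding csubspace_def
proof (intro conjI ballI allI)
  show "(\<lambda>_. 0) \<in> retract_space h"
    using csubspace_ell_inf by (auto simp: retract_space_def csubspace_def intro: uniform_limit_const)
next
  fix f g assume "f \<in> retract_space h" "g \<in> retract_space h"
  then show "(\<lambda>i. f i + g i) \<in> retract_space h"
    using csubspace_ell_inf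
    by (auto simp: retract_space_def csubspace_def intro: uniform_limit_add tendsto_add_zero)
next
  fix c f assume "f \<in> retract_space h"
  then show "(\<lambda>i. c * f i) \<in> retract_space h"
    using csubspace_ell_inf
    by (auto simp: retract_space_def csubspace_def
        intro: tendsto_mult_right_zero bounded_linear.uniform_limit[OF bounded_linear_mult_right])
qed

lemma retract_space_mult:
  assumes "f \<in> retract_space h" "g \<in> retract_space h"
  shows "(\<lambda>s. f s * g s) \<in> retract_space h"
proof -
  have fg: "f \<in> ell_inf" "g \<in> ell_inf"
    using assms by (auto simp: retract_space_def)
  have "(\<lambda>s. f s * g s) \<in> ell_inf"
    by (rule ell_infI[of _ "ell_inf_norm f * ell_inf_norm g"])
      (auto simp: norm_mult fg intro!: mult_mono ell_inf_norm_upper ell_inf_norm_nonneg)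
  then show ?thesis
    using assms fg
    by (auto simp: retract_space_def intro!: uniform_lim_mult bounded_of_ell_inf tendsto_mult_zero)
qed

text \<open>The usual argument that uniform limits inherit uniform convergence and decay. It serves
  twice: for norm closedness, and for the module action, where the approximants come from finitely
  supported elements of \<ell>1.\<close>

lemma retract_space_approx:
  assumes approx: "\<And>e. e > 0 \<Longrightarrow> \<exists>g\<in>retract_space h. \<forall>s. norm (f s - g s) \<le> e"
  shows "f \<in> retract_space h"
  unfolding retract_space_def
proof (intro CollectI conjI allI)
  obtain g where g: "g \<in> retract_space h" "\<And>s. norm (f s - g s) \<le> 1"
    using approx[of 1] by auto
  have "norm (f s) \<le> ell_inf_norm g + 1" for s
    using norm_triangle_sub[of "f s" "g s"] g(2)[of s] ell_inf_norm_upper[of g s] g(1)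
    by (auto simp: retract_space_def)
  then show "f \<in> ell_inf" by (rule ell_infI)
next
  show "uniform_limit UNIV (\<lambda>N s. f (h N s)) f sequentially"
  proof (rule uniform_limitI)
    fix e :: real assume "e > 0"
    then obtain g where g: "g \<in> retract_space h" "\<And>s. norm (f s - g s) \<le> e / 4"
      using approx[of "e / 4"] by auto
    from g(1) have "uniform_limit UNIV (\<lambda>N s. g (h N s)) g sequentially"
      by (simp add: retract_space_def)
    from uniform_limitD[OF this, of "e / 4"] \<open>e > 0\<close>
    have "\<forall>\<^sub>F N in sequentially. \<forall>s\<in>UNIV. dist (g (h N s)) (g s) < e / 4" by simp
    then show "\<forall>\<^sub>F N in sequentially. \<forall>s\<in>UNIV. dist (f (h N s)) (f s) < e"
    proof eventually_elim
      case (elim N)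
      have "dist (f (h N s)) (f s) < e" for s
        using g(2)[of s] g(2)[of "h N s"] elim[rule_format, of s] \<open>e > 0\<close>
          dist_triangle[of "f (h N s)" "f s" "g (h N s)"] dist_triangle[of "g (h N s)" "f s" "g s"]
        by (simp add: dist_norm[of "f s" "g s"] dist_norm[of "f (h N s)" "g (h N s)"] dist_commute[of "g s"])
      then show ?case by simp
    qed
  qed
next
  fix N
  show "(f \<longlongrightarrow> 0) (inf cofinite (principal {s. h N s = s}))"
  proof (rule tendstoI)
    fix e :: real assume "e > 0"
    then obtain g where g: "g \<in> retract_space h" "\<And>s. norm (f s - g s) \<le> e / 2"
      using approx[of "e / 2"] by auto
    from g(1) have "(g \<longlongrightarrow> 0) (inf cofinite (principal {s. h N s = s}))"
      by (simp add: retract_space_def)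
    from tendstoD[OF this, of "e / 2"] \<open>e > 0\<close>
    have "\<forall>\<^sub>F s in inf cofinite (principal {s. h N s = s}). dist (g s) 0 < e / 2" by simp
    then show "\<forall>\<^sub>F s in inf cofinite (principal {s. h N s = s}). dist (f s) 0 < e"
    proof eventually_elim
      case (elim s)
      then show ?case
        using g(2)[of s] norm_triangle_sub[of "f s" "g s"] by simp
    qed
  qed
qed

lemma closedin_retract_space: "closedin (norm_topology ell_inf ell_inf_norm) (retract_space h)"
proof -
  interpret Metric_space ell_inf "norm_dist ell_inf ell_inf_norm"
    by (rule Metric_space_ell_inf)
  have "\<exists>e>0. disjnt (retract_space h) (mball f e)" if f: "f \<in> ell_inf - retract_space h" for f
  proof (rule ccontr)
    assume no: "\<not> ?thesis"
    have "f \<in> retract_space h"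
    proof (rule retract_space_approx)
      fix e :: real assume "e > 0"
      with no obtain g where g: "g \<in> retract_space h" "g \<in> mball f e"
        unfolding disjnt_def by blast
      then have gl: "g \<in> ell_inf" and "norm_dist ell_inf ell_inf_norm f g < e"
        by auto
      then have "ell_inf_norm (\<lambda>s. f s - g s) < e"
        using f by (simp add: norm_dist_def)
      moreover have "norm (f s - g s) \<le> ell_inf_norm (\<lambda>s. f s - g s)" for s
        using ell_inf_norm_upper[OF csubspace_diff[OF csubspace_ell_inf, of f g]] f gl by simp
      ultimately show "\<exists>g\<in>retract_space h. \<forall>s. norm (f s - g s) \<le> e"
        using g(1) by (meson less_imp_le order_trans)
    qed
    with f show False by simp
  qed
  then show ?thesis
    unfolding norm_topology_def closedin_metric using retract_space_subset by blast
qed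

text \<open>The nearest-point projection onto the disc of radius \<open>e\<close> is the truncation
  used below. Being 1-Lipschitz it preserves uniform limits; as it fixes 0, it does not increase the
  modulus and so preserves decay.\<close>

lemma closest_point_cball_0:
  fixes z w :: complex
  assumes "e > 0"
  shows "dist (closest_point (cball 0 e) z) (closest_point (cball 0 e) w) \<le> dist z w"
    and "norm (closest_point (cball 0 e) z) \<le> e"
    and "norm z \<le> e \<Longrightarrow> closest_point (cball 0 e) z = z"
    and "norm (closest_point (cball 0 e) z) \<le> norm z"
proof -
  show 1: "dist (closest_point (cball 0 e) z) (closest_point (cball 0 e) w) \<le> dist z w" for w
    using assms by (intro closest_point_lipschitz) auto
  show "norm (closest_point (cball 0 e) z) \<le> e"
    using closest_point_in_set[of "cball 0 e" z] assms by auto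
  show 3: "closest_point (cball 0 e) z = z" if "norm z \<le> e" for z :: complex
    using that by (intro closest_point_self) auto
  show "norm (closest_point (cball 0 e) z) \<le> norm z"
    using 1[of 0] 3[of 0] assms by simp
qed

lemma retract_space_truncate:
  assumes f: "f \<in> retract_space h" and e: "e > 0"
  shows "(\<lambda>s. closest_point (cball 0 e) (f s)) \<in> retract_space h"
  unfolding retract_space_def
proof (intro CollectI conjI allI)
  show "(\<lambda>s. closest_point (cball 0 e) (f s)) \<in> ell_inf"
    using closest_point_cball_0(2)[OF e] by (rule ell_infI)
  show "uniform_limit UNIV (\<lambda>N s. closest_point (cball 0 e) (f (h N s)))
      (\<lambda>s. closest_point (cball 0 e) (f s)) sequentially"
  proof (rule uniform_limitI)
    fix d :: real assume "d > 0"
    moreover have "uniform_limit UNIV (\<lambda>N s. f (h N s)) f sequentially"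
      using f by (simp add: retract_space_def)
    ultimately have "\<forall>\<^sub>F N in sequentially. \<forall>s\<in>UNIV. dist (f (h N s)) (f s) < d"
      by (rule uniform_limitD[rotated])
    then show "\<forall>\<^sub>F N in sequentially. \<forall>s\<in>UNIV.
        dist (closest_point (cball 0 e) (f (h N s))) (closest_point (cball 0 e) (f s)) < d"
      by eventually_elim (use closest_point_cball_0(1)[OF e] le_less_trans in blast)
  qed
  show "((\<lambda>s. closest_point (cball 0 e) (f s)) \<longlongrightarrow> 0) (inf cofinite (principal {s. h N s = s}))" for N
  proof (rule Lim_null_comparison)
    show "((\<lambda>s. norm (f s)) \<longlongrightarrow> 0) (inf cofinite (principal {s. h N s = s}))"
      using f by (auto simp: retract_space_def intro: tendsto_norm_zero)
  qed (simp add: closest_point_cball_0(4)[OF e])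
qed

text \<open>The set of all \<open>s\<close> with \<open>h N s = m\<close> is a basic compact neighbourhood of \<open>m\<close> when \<open>h N m = m\<close>.
  By \<open>rank_less\<close> all its other points have lower rank, so \<open>r\<close> bounds the Cantor--Bendixson rank.\<close>

locale retractions =
  fixes h :: "nat \<Rightarrow> 's \<Rightarrow> 's" and r :: "'s \<Rightarrow> nat"
  assumes h_h_above: "N \<le> M \<Longrightarrow> h N (h M s) = h N s"
    and h_h_below: "N \<le> M \<Longrightarrow> h M (h N s) = h N s"
    and eventually_fixed: "\<forall>\<^sub>F N in sequentially. h N s = s"
    and rank_less: "h N s \<noteq> s \<Longrightarrow> r s < r (h N s)"
    and finite_fibre: "finite {s. h M s = s \<and> h N s = m}"
begin

section \<open>Indicators of fibres, and how rank controls large values\<close>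

lemma eventually_fixed_on: "finite F \<Longrightarrow> \<forall>\<^sub>F N in sequentially. \<forall>s\<in>F. h N s = s"
  by (intro eventually_ball_finite ballI eventually_fixed)

lemma rank_le: "r s \<le> r (h N s)"
  using rank_less[of N s] by (cases "h N s = s") auto

text \<open>The indicator of a fibre of \<open>h N\<close> is unchanged by composition with
  \<open>h M\<close> once \<open>M >= N\<close>, so the uniform limit is attained. The decay
  condition is \<open>finite_fibre\<close>.\<close>

lemma unit_vec_retract: "(\<lambda>s. unit_vec m (h N s)) \<in> retract_space h"
  unfolding retract_space_def
proof (intro CollectI conjI allI)
  show "(\<lambda>s. unit_vec m (h N s)) \<in> ell_inf"
    by (rule ell_infI[of _ 1]) (simp add: unit_vec_def)
  show "uniform_limit UNIV (\<lambda>M s. unit_vec m (h N (h M s))) (\<lambda>s. unit_vec m (h N s)) sequentially"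
    by (rule uniform_limitI) (auto simp: eventually_sequentially h_h_above intro!: exI[of _ N])
  fix M
  have "finite {s. \<not> (h M s = s \<longrightarrow> unit_vec m (h N s) = 0)}"
    by (rule finite_subset[OF _ finite_fibre[of M N m]]) (auto simp: unit_vec_def)
  then have "\<forall>\<^sub>F s in inf cofinite (principal {s. h M s = s}). unit_vec m (h N s) = 0"
    by (simp add: eventually_inf_principal eventually_cofinite)
  then show "((\<lambda>s. unit_vec m (h N s)) \<longlongrightarrow> 0) (inf cofinite (principal {s. h M s = s}))"
    by (rule tendsto_eventually)
qed

lemma retract_space_finite_large:
  assumes "f \<in> retract_space h" "e > 0"
  shows "finite {s. h N s = s \<and> norm (f s) \<ge> e}"
proof -
  from assms(1) have "(f \<longlongrightarrow> 0) (inf cofinite (principal {s. h N s = s}))"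
    by (simp add: retract_space_def)
  from tendstoD[OF this assms(2)] show ?thesis
    by (simp add: eventually_inf_principal eventually_cofinite not_less)
qed

lemma retract_space_near:
  assumes "f \<in> retract_space h" "e > 0"
  obtains N where "\<And>s. norm (f (h N s) - f s) < e"
proof -
  from assms(1) have "uniform_limit UNIV (\<lambda>N s. f (h N s)) f sequentially"
    by (simp add: retract_space_def)
  from uniform_limitD[OF this assms(2)] show thesis
    using that by (auto simp: eventually_sequentially dist_norm)
qed

text \<open>For a suitable \<open>N\<close>, a point where \<open>f\<close> is large is sent by
  \<open>h N\<close> to one of finitely many fixed points where \<open>f\<close> is still large, and
  \<open>h N\<close> does not lower the rank.\<close>

lemma retract_space_rank_bounded:
  assumes f: "f \<in> retract_space h" and e: "e > 0"
  obtains k where "\<And>s. norm (f s) \<ge> e \<Longrightarrow> r s < k"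
proof -
  obtain N where N: "\<And>s. norm (f (h N s) - f s) < e / 2"
    using retract_space_near[OF f, of "e / 2"] e by auto
  define B where "B = {s. h N s = s \<and> norm (f s) \<ge> e / 2}"
  have "finite (r ` B)"
    using retract_space_finite_large[OF f, of "e / 2" N] e by (simp add: B_def)
  then obtain k where k: "\<And>s. s \<in> B \<Longrightarrow> r s < k"
    by (auto simp: finite_nat_set_iff_bounded)
  have "r s < k" if "norm (f s) \<ge> e" for s
  proof -
    have "norm (f (h N s)) \<ge> e / 2"
      using N[of s] norm_triangle_ineq3[of "f (h N s)" "f s"] that by linarith
    then have "h N s \<in> B" by (simp add: B_def h_h_below)
    then show ?thesis using k rank_le le_less_trans by blast
  qed
  then show thesis by (rule that)
qed

text \<open>If \<open>h N\<close> moved such a point, its image would have rank above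
  \<open>k\<close>, where \<open>f\<close> vanishes, although \<open>f\<close> changes by less than
  \<open>e\<close> along \<open>h N\<close>. So these points are all fixed by one
  \<open>h N\<close>, and there the decay condition applies.\<close>

lemma retract_space_finite_top_rank:
  assumes f: "f \<in> retract_space h" and vanish: "\<And>s. r s > k \<Longrightarrow> f s = 0" and e: "e > 0"
  shows "finite {s. r s = k \<and> norm (f s) \<ge> e}"
proof -
  obtain N where N: "\<And>s. norm (f (h N s) - f s) < e"
    using retract_space_near[OF f e] by auto
  have "h N s = s" if "r s = k" "norm (f s) \<ge> e" for s
  proof -
    have "f (h N s) \<noteq> 0" using N[of s] that(2) by auto
    then have "r (h N s) \<le> k" using vanish not_less by blast
    then show ?thesis using rank_less[of N s] that(1) by linarith
  qed
  then show ?thesis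
    by (intro finite_subset[OF _ retract_space_finite_large[OF f e, of N]]) auto
qed

text \<open>This is dominated convergence: on each finite set the functions equal \<open>g\<close>
  from some \<open>N\<close> on. The function \<open>g\<close> is any bounded function, not only a
  member of \<open>retract_space h\<close>.\<close>

lemma pairing_retract_tendsto:
  assumes a: "a \<in> ell1" and C: "\<And>s. norm (g s) \<le> C"
  shows "(\<lambda>N. pairing (\<lambda>s. g (h N s)) a) \<longlonglongrightarrow> pairing g a"
proof (rule tendstoI)
  fix e :: real assume e: "e > 0"
  have C0: "C \<ge> 0" using C norm_ge_zero order_trans by blast
  \<comment> \<open>The differences below are bounded by \<open>2 * C\<close>; the added 1 keeps the
    denominator positive and the final bound strict.\<close>
  obtain F where F: "finite F" "(\<Sum>\<^sub>\<infinity>s\<in>-F. norm (a s)) \<le> e / (2 * C + 1)"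
    using ell1_small_tail[OF a, of "e / (2 * C + 1)"] e C0 by auto
  from eventually_fixed_on[OF F(1)]
  show "\<forall>\<^sub>F N in sequentially. dist (pairing (\<lambda>s. g (h N s)) a) (pairing g a) < e"
  proof eventually_elim
    case (elim N)
    have "pairing (\<lambda>s. g (h N s)) a - pairing g a = pairing (\<lambda>s. g (h N s) - g s) a"
      by (rule pairing_diff[symmetric, OF a]) (auto intro: ell_infI C)
    also have "norm \<dots> \<le> (2 * C) * (\<Sum>\<^sub>\<infinity>s\<in>-F. norm (a s))"
    proof (rule norm_pairing_le[OF a])
      show "norm (g (h N s) - g s) \<le> 2 * C" for s
        using norm_triangle_ineq4[of "g (h N s)" "g s"] C[of s] C[of "h N s"] by linarith
    qed (use elim in auto)
    also have "\<dots> \<le> (2 * C) * (e / (2 * C + 1))"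
      using F(2) C0 by (intro mult_left_mono) auto
    also have "\<dots> < e" using e C0 by (simp add: field_simps)
    finally show ?case by (simp add: dist_norm)
  qed
qed

text \<open>The natural test function, the conjugate phase of \<open>a\<close> on a finite set, may
  lie outside the space. Its composites with \<open>h N\<close> lie inside, still have norm at most
  1, and their pairings with \<open>a\<close> converge to the desired sum.\<close>

lemma ell1_norm_le_dual_norm:
  assumes a: "a \<in> ell1"
  shows "ell1_norm a \<le> dual_norm (retract_space h) (canonical_map (retract_space h) a)"
    (is "_ \<le> ?D")
  unfolding ell1_norm_def
proof (rule infsum_le_finite_sums)
  show "(\<lambda>s. norm (a s)) summable_on UNIV" using a by (simp add: ell1_def)
  fix F :: "'s set" assume F: "finite F"
  note sub = csubspace_retract_space[of h]
  have can: "canonical_map (retract_space h) a \<in> dual_space (retract_space h)"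
    by (rule canonical_map_in_dual_space[OF sub retract_space_subset a])
  define g where "g s = (if s \<in> F then cnj (sgn (a s)) else 0)" for s
  have g1: "norm (g s) \<le> 1" for s
    by (simp add: g_def norm_sgn)
  have "norm (pairing (\<lambda>s. g (h N s)) a) \<le> ?D" for N
  proof -
    have "(\<lambda>s. g (h N s)) = (\<lambda>s. \<Sum>m\<in>F. cnj (sgn (a m)) * unit_vec m (h N s))"
      by (auto simp: g_def unit_vec_def F fun_eq_iff if_distrib[of "(*) _"] sum.delta cong: if_cong)
    then have E: "(\<lambda>s. g (h N s)) \<in> retract_space h"
      by (simp add: csubspace_sum[OF sub F] unit_vec_retract)
    have "norm (canonical_map (retract_space h) a (\<lambda>s. g (h N s))) \<le> ?D * ell_inf_norm (\<lambda>s. g (h N s))"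
      by (rule dual_norm_upper[OF sub retract_space_subset can E])
    also have "\<dots> \<le> ?D * 1"
      by (intro mult_left_mono ell_inf_norm_least g1 dual_norm_nonneg[OF sub retract_space_subset can])
    finally show ?thesis using E by (simp add: canonical_map_def)
  qed
  then have "norm (pairing g a) \<le> ?D"
    by (intro Lim_bounded[OF tendsto_norm[OF pairing_retract_tendsto[OF a g1]]]) auto
  also have "pairing g a = (\<Sum>s\<in>F. complex_of_real (norm (a s)))"
  proof -
    show ?thesis
      by (subst pairing_finite_support[OF F]) (auto simp: g_def mult_cnj_sgn intro: sum.cong)
  qed
  also have "\<dots> = complex_of_real (\<Sum>s\<in>F. norm (a s))" by simp
  finally show "(\<Sum>s\<in>F. norm (a s)) \<le> ?D"
    by (simp only: norm_of_real)
qed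

text \<open>By induction on \<open>k\<close>, the functional vanishes on functions that vanish at rank \<open>k\<close> and above:
  subtracting finitely many multiples of atoms makes such a function small at rank \<open>k - 1\<close> and above,
  and truncation removes the small values at the cost of a small error. By
  \<open>retract_space_rank_bounded\<close>, truncation also reduces the general case to this one.\<close>

lemma dual_space_eq_0:
  assumes \<psi>: "\<psi> \<in> dual_space (retract_space h)"
    and atoms: "\<And>m e N0. e > 0 \<Longrightarrow> \<exists>N\<ge>N0. norm (\<psi> (\<lambda>s. unit_vec m (h N s))) < e"
    and f: "f \<in> retract_space h"
  shows "\<psi> f = 0"
proof -
  let ?E = "retract_space h"
  note sub = csubspace_retract_space[of h]
  note ub = dual_norm_upper[OF sub retract_space_subset \<psi>]
  note diff = csubspace_diff[OF sub] and \<psi>_diff = dual_space_diff[OF sub \<psi>]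
  define C where "C = dual_norm ?E \<psi>"
  have C0: "C \<ge> 0" unfolding C_def by (rule dual_norm_nonneg[OF sub retract_space_subset \<psi>])
  have trunc: "norm (\<psi> g) \<le> C * e"
    if vanish: "\<And>f. f \<in> ?E \<Longrightarrow> (\<And>s. r s \<ge> k \<Longrightarrow> f s = 0) \<Longrightarrow> \<psi> f = 0"
      and g: "g \<in> ?E" "\<And>s. r s \<ge> k \<Longrightarrow> norm (g s) \<le> e" "e > 0" for k g e
  proof -
    let ?t = "\<lambda>s. closest_point (cball 0 e) (g s)"
    have t: "?t \<in> ?E" by (rule retract_space_truncate[OF g(1,3)])
    have "\<psi> (\<lambda>s. g s - ?t s) = 0"
      by (rule vanish[OF diff[OF g(1) t]]) (simp add: closest_point_cball_0(3) g)
    then have "\<psi> g = \<psi> ?t" by (simp add: \<psi>_diff g(1) t)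
    moreover have "C * ell_inf_norm ?t \<le> C * e"
      by (intro mult_left_mono[OF _ C0] ell_inf_norm_least closest_point_cball_0(2) g)
    ultimately show ?thesis using ub[OF t] by (simp add: C_def)
  qed
  have small: "z = 0" if "\<And>e. e > 0 \<Longrightarrow> norm z \<le> C * e" for z :: complex
  proof (rule ccontr)
    assume "z \<noteq> 0"
    \<comment> \<open>This \<open>e\<close> would give a bound for the norm of \<open>z\<close> by
      \<open>C / (C + 1) < 1\<close> times itself.\<close>
    with that[of "norm z / (C + 1)"] C0 have "norm z \<le> C * (norm z / (C + 1))" by simp
    with \<open>z \<noteq> 0\<close> C0 show False by (simp add: field_simps)
  qed
  have vanish: "\<psi> f = 0" if "f \<in> ?E" "\<And>s. r s \<ge> k \<Longrightarrow> f s = 0" for f k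
    using that
  proof (induction k arbitrary: f)
    case 0
    then have "ell_inf_norm f = 0" by (simp add: ell_inf_norm_def)
    with ub[OF 0(1)] show ?case by simp
  next
    case (Suc k)
    \<comment> \<open>At rank \<open>k\<close> and above, the fibre over \<open>m\<close> consists
      of \<open>m\<close> alone whenever \<open>h N\<close> fixes \<open>m\<close>. Indicators for
      two such levels therefore differ by a function covered by the induction hypothesis, so their
      values under \<psi> agree, and \<open>atoms\<close> makes the common value 0.\<close>
    have atom: "\<psi> (\<lambda>s. unit_vec m (h N s)) = 0" if m: "r m = k" "h N m = m" for m N
    proof (rule small)
      fix e :: real assume e: "e > 0"
      obtain N0 where N0: "\<And>N. N \<ge> N0 \<Longrightarrow> h N m = m"
        using eventually_fixed[of m] by (auto simp: eventually_sequentially)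
      have eq: "unit_vec m (h N' s) = unit_vec m s" if "r s \<ge> k" "h N' m = m" for N' s
        using rank_less[of N' s] that m(1) by (cases "h N' s = s") (auto simp: unit_vec_def)
      have "\<psi> (\<lambda>s. unit_vec m (h N s)) = \<psi> (\<lambda>s. unit_vec m (h N' s))" if "N' \<ge> N0" for N'
      proof -
        have "\<psi> (\<lambda>s. unit_vec m (h N s) - unit_vec m (h N' s)) = 0"
          by (rule Suc.IH[OF diff[OF unit_vec_retract unit_vec_retract]])
            (simp add: eq m N0 that)
        then show ?thesis by (simp add: \<psi>_diff unit_vec_retract)
      qed
      moreover have "norm (\<psi> (\<lambda>s. unit_vec m (h N s))) \<le> e" if "e > 0" for e
        using atoms[OF that, of N0 m] calculation by auto
      then have "\<psi> (\<lambda>s. unit_vec m (h N s)) = 0"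
        by (metis dense_ge norm_le_zero_iff)
      then show "norm (\<psi> (\<lambda>s. unit_vec m (h N s))) \<le> C * e" using C0 e by simp
    qed
    show ?case
    proof (rule small)
      fix e :: real assume e: "e > 0"
      define F where "F = {s. r s = k \<and> norm (f s) \<ge> e}"
      have F: "finite F"
        unfolding F_def by (rule retract_space_finite_top_rank[OF Suc.prems(1) _ e]) (simp add: Suc.prems)
      obtain N where N: "\<And>s. s \<in> F \<Longrightarrow> h N s = s"
        using eventually_fixed_on[OF F] by (auto simp: eventually_sequentially)
      \<comment> \<open>This combination of atoms of rank \<open>k\<close> agrees with
        \<open>f\<close> on \<open>F\<close>. At all other points of rank at least \<open>k\<close>
        it is 0, since reaching \<open>F\<close> by a proper move under \<open>h N\<close> requires
        lower rank.\<close>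
      let ?g = "\<lambda>s. \<Sum>m\<in>F. f m * unit_vec m (h N s)"
      have g: "?g \<in> ?E" by (intro csubspace_sum[OF sub F] unit_vec_retract)
      have g_eq: "?g s = (if h N s \<in> F then f (h N s) else 0)" for s
        by (auto simp: unit_vec_def F if_distrib[of "(*) _"] sum.delta cong: if_cong)
      have "\<psi> ?g = (\<Sum>m\<in>F. f m * \<psi> (\<lambda>s. unit_vec m (h N s)))"
        by (rule dual_space_sum[OF sub \<psi> F unit_vec_retract])
      also have "\<dots> = 0"
        by (rule sum.neutral) (auto simp: N atom F_def)
      finally have "\<psi> f = \<psi> (\<lambda>s. f s - ?g s)"
        by (simp only: \<psi>_diff[OF Suc.prems(1) g]) simp
      moreover have "norm (\<psi> (\<lambda>s. f s - ?g s)) \<le> C * e"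
      proof (rule trunc[OF Suc.IH diff[OF Suc.prems(1) g] _ e])
        fix s assume s: "r s \<ge> k"
        have *: "h N s = s" if "h N s \<in> F"
          using rank_less[of N s] s that by (auto simp: F_def)
        show "norm (f s - ?g s) \<le> e"
        proof (cases "s \<in> F")
          case True
          then show ?thesis unfolding g_eq using e N[of s] by simp
        next
          case False
          then have "h N s \<notin> F" using * by auto
          moreover have "norm (f s) \<le> e"
          proof (cases "r s = k")
            case True
            with False show ?thesis by (simp add: F_def)
          next
            case False
            then have "f s = 0" using s Suc.prems(2) by simp
            then show ?thesis using e by simp
          qed
          ultimately show ?thesis unfolding g_eq by simp
        qed
      qed
      ultimately show "norm (\<psi> f) \<le> C * e" by simp
    qed
  qed
  show ?thesis
  proof (rule small)
    fix e :: real assume e: "e > 0"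
    obtain k where k: "\<And>s. norm (f s) \<ge> e \<Longrightarrow> r s < k"
      using retract_space_rank_bounded[OF f e] by auto
    show "norm (\<psi> f) \<le> C * e"
    proof (rule trunc[OF vanish f _ e])
      fix s assume "r s \<ge> k"
      then show "norm (f s) \<le> e" using k[of s] by linarith
    qed
  qed
qed

text \<open>Convergence of \<phi> on shrinking fibres is not known beforehand, so the mass at
  \<open>m\<close> is a limit along a subsequence depending on \<open>m\<close>. Testing \<phi> on
  disjoint fibres bounds the total mass, and \<open>dual_space_eq_0\<close> disposes of the
  remainder.\<close>

lemma dual_space_represented:
  assumes \<phi>: "\<phi> \<in> dual_space (retract_space h)"
  shows "\<exists>a\<in>ell1. \<forall>f\<in>retract_space h. \<phi> f = pairing f a"
proof -
  let ?E = "retract_space h" and ?u = "\<lambda>m N s. unit_vec m (h N s)"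
  note sub = csubspace_retract_space[of h]
  note ub = dual_norm_upper[OF sub retract_space_subset \<phi>]
  define C where "C = dual_norm ?E \<phi>"
  have C0: "C \<ge> 0" unfolding C_def by (rule dual_norm_nonneg[OF sub retract_space_subset \<phi>])
  have "norm (\<phi> (?u m N)) \<le> C" for m N
  proof -
    have "C * ell_inf_norm (?u m N) \<le> C * 1"
      by (intro mult_left_mono C0 ell_inf_norm_least) (simp add: unit_vec_def)
    then show ?thesis using ub[OF unit_vec_retract, of m N] by (simp add: C_def)
  qed
  then have "bounded (range (\<lambda>N. \<phi> (?u m N)))" for m
    by (auto simp: bounded_iff)
  then have "\<exists>a \<sigma>. strict_mono \<sigma> \<and> ((\<lambda>N. \<phi> (?u m N)) \<circ> \<sigma>) \<longlonglongrightarrow> a" for m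
    using bounded_imp_convergent_subsequence by blast
  then obtain a \<sigma> where \<sigma>: "\<And>m. strict_mono (\<sigma> m :: nat \<Rightarrow> nat)"
    and lim: "\<And>m. (\<lambda>i. \<phi> (?u m (\<sigma> m i))) \<longlonglongrightarrow> a m"
    unfolding o_def by metis
  have cluster: "\<exists>N\<ge>N0. norm (\<phi> (?u m N) - a m) < e" if "e > 0" for m e N0
  proof -
    have "\<forall>\<^sub>F i in sequentially. norm (\<phi> (?u m (\<sigma> m i)) - a m) < e \<and> N0 \<le> i"
      using tendstoD[OF lim that, of m] eventually_ge_at_top[of N0]
      by eventually_elim (simp add: dist_norm)
    then obtain i where "norm (\<phi> (?u m (\<sigma> m i)) - a m) < e" "N0 \<le> i"
      using eventually_happens by force
    then show ?thesis
      using seq_suble[OF \<sigma>, of i m] by (intro exI[of _ "\<sigma> m i"]) auto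
  qed
  have sum_le: "(\<Sum>m\<in>F. norm (a m)) \<le> C" if F: "finite F" for F
  proof (rule field_le_epsilon)
    fix e :: real assume e: "e > 0"
    define d where "d = e / (card F + 1)"
    have d: "d > 0" using e by (simp add: d_def)
    obtain N0 where N0: "\<And>N m. N \<ge> N0 \<Longrightarrow> m \<in> F \<Longrightarrow> h N m = m"
      using eventually_fixed_on[OF F] by (auto simp: eventually_sequentially)
    from cluster[OF d, of N0] obtain N where N: "\<And>m. N m \<ge> N0" "\<And>m. norm (\<phi> (?u m (N m)) - a m) < d"
      by metis
    define c where "c m = cnj (sgn (\<phi> (?u m (N m))))" for m
    let ?f = "\<lambda>s. \<Sum>m\<in>F. c m * ?u m (N m) s"
    \<comment> \<open>Each \<open>m\<close> has its own level \<open>N m\<close>, so disjointness of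
      the fibres needs an argument: the map of the lower level factors through that of the higher
      one and fixes all of \<open>F\<close>. Hence at most one term of \<open>?f\<close> is nonzero
      at any point.\<close>
    have "m = m'" if "m \<in> F" "m' \<in> F" "h (N m) s = m" "h (N m') s = m'" "N m \<le> N m'" for m m' s
      using h_h_above[OF that(5), of s] that N0[OF N(1)] by metis
    then have unique: "m = m'" if "m \<in> F" "m' \<in> F" "h (N m) s = m" "h (N m') s = m'" for m m' s
      using that by (metis nat_le_linear)
    have f1: "norm (?f s) \<le> 1" for s
    proof (cases "\<exists>m\<in>F. h (N m) s = m")
      case True
      then obtain m where m: "m \<in> F" "h (N m) s = m" by blast
      then have "?f s = (\<Sum>m'\<in>{m}. c m' * ?u m' (N m') s)"
        using unique by (intro sum.mono_neutral_right F) (auto simp: unit_vec_def)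
      then show ?thesis by (simp add: c_def unit_vec_def norm_mult norm_sgn)
    next
      case False
      then have "?f s = 0" by (intro sum.neutral) (auto simp: unit_vec_def)
      then show ?thesis by simp
    qed
    have fE: "?f \<in> ?E" by (intro csubspace_sum[OF sub F] unit_vec_retract)
    have "complex_of_real (\<Sum>m\<in>F. norm (\<phi> (?u m (N m)))) = (\<Sum>m\<in>F. c m * \<phi> (?u m (N m)))"
      by (simp add: c_def mult_cnj_sgn mult.commute[of "cnj _"])
    also have "\<dots> = \<phi> ?f"
      by (rule dual_space_sum[OF sub \<phi> F unit_vec_retract, symmetric])
    finally have eq: "complex_of_real (\<Sum>m\<in>F. norm (\<phi> (?u m (N m)))) = \<phi> ?f" .
    have "(\<Sum>m\<in>F. norm (\<phi> (?u m (N m)))) \<le> norm (\<phi> ?f)"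
      by (simp only: eq[symmetric] norm_of_real abs_ge_self)
    also have "\<dots> \<le> C * ell_inf_norm ?f" using ub[OF fE] by (simp add: C_def)
    also have "\<dots> \<le> C * 1" by (intro mult_left_mono C0 ell_inf_norm_least f1)
    finally have "(\<Sum>m\<in>F. norm (\<phi> (?u m (N m)))) \<le> C" by simp
    moreover have "(\<Sum>m\<in>F. norm (a m)) \<le> (\<Sum>m\<in>F. norm (\<phi> (?u m (N m))) + d)"
    proof (rule sum_mono)
      fix m
      show "norm (a m) \<le> norm (\<phi> (?u m (N m))) + d"
        using N(2)[of m] norm_triangle_ineq2[of "a m" "\<phi> (?u m (N m))"]
        by (simp add: norm_minus_commute)
    qed
    moreover have "card F * d \<le> e"
      using e by (simp add: d_def field_simps)
    ultimately show "(\<Sum>m\<in>F. norm (a m)) \<le> C + e"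
      by (simp add: sum.distrib)
  qed
  have a: "a \<in> ell1"
    unfolding ell1_def
    by (auto intro!: nonneg_bdd_above_summable_on bdd_aboveI2[of _ _ C] sum_le)
  define \<psi> where "\<psi> f = \<phi> f - canonical_map ?E a f" for f
  have \<psi>: "\<psi> \<in> dual_space ?E"
    unfolding \<psi>_def
    by (rule csubspace_diff[OF csubspace_dual_space[OF sub retract_space_subset] \<phi>
          canonical_map_in_dual_space[OF sub retract_space_subset a]])
  have "\<psi> f = 0" if "f \<in> ?E" for f
  proof (rule dual_space_eq_0[OF \<psi> _ that])
    fix m N0 and e :: real assume e: "e > 0"
    \<comment> \<open>The fibres over \<open>m\<close> shrink to \<open>m\<close>, so the pairings
      converge to the mass that was chosen as a cluster value of \<phi>; the two contributions
      cancel for arbitrarily large \<open>N\<close>.\<close>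
    have "(\<lambda>N. pairing (?u m N) a) \<longlonglongrightarrow> a m"
      using pairing_retract_tendsto[OF a, of "unit_vec m" 1] pairing_unit_vec[of m a]
      by (simp add: unit_vec_def)
    from tendstoD[OF this, of "e / 2"] e
    obtain N1 where N1: "\<And>N. N \<ge> N1 \<Longrightarrow> norm (pairing (?u m N) a - a m) < e / 2"
      by (auto simp: eventually_sequentially dist_norm)
    obtain N where N: "N \<ge> max N0 N1" "norm (\<phi> (?u m N) - a m) < e / 2"
      using cluster[of "e / 2"] e by (meson half_gt_zero)
    have "norm (\<psi> (?u m N)) < e"
      using N N1[of N] norm_triangle_ineq4[of "\<phi> (?u m N) - a m" "pairing (?u m N) a - a m"]
      by (simp add: \<psi>_def canonical_map_def unit_vec_retract)
    then show "\<exists>N\<ge>N0. norm (\<psi> (?u m N)) < e"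
      using N(1) by (intro exI[of _ N]) simp
  qed
  then show ?thesis
    using a by (auto simp: \<psi>_def canonical_map_def intro!: bexI[of _ a])
qed

end

section \<open>Translations and module actions in a cancellative commutative semigroup\<close>

locale semigroup_retractions = retractions h r
  for h :: "nat \<Rightarrow> 's::ab_semigroup_mult \<Rightarrow> 's" and r +
  assumes h_mult: "h N (s * t) = h N s * h N t"
    and inj_mult: "inj ((*) s)"
begin

text \<open>As soon as \<open>h N\<close> fixes \<open>s\<close>, it commutes with multiplication by
  \<open>s\<close>, which gives the uniform limit. Decay holds because multiplication by
  \<open>s\<close> is injective and maps fixed points of \<open>h N\<close> to fixed points of some
  later \<open>h M\<close>.\<close>

lemma translate_retract_space:
  assumes f: "f \<in> retract_space h"
  shows "(\<lambda>t. f (s * t)) \<in> retract_space h"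
  unfolding retract_space_def
proof (intro CollectI conjI allI)
  have "f \<in> ell_inf" using f by (simp add: retract_space_def)
  then show "(\<lambda>t. f (s * t)) \<in> ell_inf"
    by (blast intro: ell_infI ell_inf_norm_upper)
  show "uniform_limit UNIV (\<lambda>N t. f (s * h N t)) (\<lambda>t. f (s * t)) sequentially"
  proof (rule uniform_limitI)
    fix e :: real assume e: "e > 0"
    have "uniform_limit UNIV (\<lambda>N s. f (h N s)) f sequentially"
      using f by (simp add: retract_space_def)
    from uniform_limitD[OF this e] eventually_fixed[of s]
    show "\<forall>\<^sub>F N in sequentially. \<forall>t\<in>UNIV. dist (f (s * h N t)) (f (s * t)) < e"
      by eventually_elim (metis h_mult UNIV_I)
  qed
  fix N
  obtain M where M: "M \<ge> N" "h M s = s"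
    using eventually_conj[OF eventually_fixed[of s] eventually_ge_at_top[of N]]
    by (auto simp: eventually_sequentially)
  show "((\<lambda>t. f (s * t)) \<longlongrightarrow> 0) (inf cofinite (principal {t. h N t = t}))"
  proof (rule tendstoI)
    fix e :: real assume "e > 0"
    then have "finite ((*) s -` {t. h M t = t \<and> norm (f t) \<ge> e})"
      by (intro finite_vimageI retract_space_finite_large f inj_mult)
    moreover have "h M (s * t) = s * t" if "h N t = t" for t
      using h_h_below[OF M(1), of t] that by (simp add: h_mult M(2))
    ultimately have "finite {t. h N t = t \<and> norm (f (s * t)) \<ge> e}"
      by (elim finite_subset[rotated]) auto
    then show "\<forall>\<^sub>F t in inf cofinite (principal {t. h N t = t}). dist (f (s * t)) 0 < e"
      by (simp add: eventually_inf_principal eventually_cofinite not_less)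
  qed
qed

text \<open>Cutting \<open>a\<close> off outside a finite set approximates the action uniformly by
  finite combinations of translates.\<close>

lemma right_act_retract_space:
  assumes f: "f \<in> retract_space h" and a: "a \<in> ell1"
  shows "right_act f a \<in> retract_space h"
proof (rule retract_space_approx)
  fix e :: real assume e: "e > 0"
  have fl: "f \<in> ell_inf" using f by (simp add: retract_space_def)
  define C where "C = ell_inf_norm f"
  have C: "norm (f s) \<le> C" for s unfolding C_def by (rule ell_inf_norm_upper[OF fl])
  have C0: "C \<ge> 0" unfolding C_def by (rule ell_inf_norm_nonneg[OF fl])
  obtain F where F: "finite F" "(\<Sum>\<^sub>\<infinity>s\<in>-F. norm (a s)) \<le> e / (C + 1)"
    using ell1_small_tail[OF a, of "e / (C + 1)"] e C0 by auto
  let ?g = "\<lambda>t. \<Sum>s\<in>F. a s * f (s * t)"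
  have "?g \<in> retract_space h"
    by (intro csubspace_sum[OF csubspace_retract_space F(1)] translate_retract_space f)
  moreover have "norm (right_act f a t - ?g t) \<le> e" for t
  proof -
    have "?g t = pairing (\<lambda>s. if s \<in> F then f (s * t) else 0) a"
      by (subst pairing_finite_support[OF F(1)]) auto
    moreover have "right_act f a t = pairing (\<lambda>s. f (s * t)) a"
      by (simp add: right_act_def pairing_def)
    ultimately have "right_act f a t - ?g t
        = pairing (\<lambda>s. f (s * t) - (if s \<in> F then f (s * t) else 0)) a"
      using C C0 by (subst pairing_diff[OF a]) (auto intro!: ell_infI[of _ C])
    also have "norm \<dots> \<le> C * (\<Sum>\<^sub>\<infinity>s\<in>-F. norm (a s))"
      by (rule norm_pairing_le[OF a]) (auto simp: C C0)
    also have "\<dots> \<le> C * (e / (C + 1))" by (intro mult_left_mono F C0)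
    also have "\<dots> \<le> e" using e C0 by (simp add: field_simps)
    finally show ?thesis .
  qed
  ultimately show "\<exists>g\<in>retract_space h. \<forall>t. norm (right_act f a t - g t) \<le> e"
    by (intro bexI[of _ ?g]) auto
qed

theorem hopf_algebra_predual_retract_space: "hopf_algebra_predual (retract_space h)"
proof -
  have "left_act a f = right_act f a" for a f :: "'s \<Rightarrow> complex"
    by (simp add: left_act_def right_act_def mult.commute)
  then have "closed_sub_bimodule (retract_space h)"
    by (simp add: closed_sub_bimodule_def csubspace_retract_space closedin_retract_space
        right_act_retract_space)
  then have "predual (retract_space h)"
    by (rule predualI_isometric[OF _ retract_space_subset ell1_norm_le_dual_norm dual_space_represented])
  then show ?thesis
    by (simp add: hopf_algebra_predual_def retract_space_mult)
qed

end

section \<open>A topology on the primes for each set of colours\<close>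

text \<open>Some enumeration of the primes is composed with a bijection to pairs of naturals; a
  colour class is a row of the resulting array.\<close>

definition prime_colour :: "nat \<Rightarrow> nat" where
  "prime_colour p = fst (prod_decode (to_nat_on {p. prime p} p))"

lemma infinite_prime_colour: "infinite {p. prime p \<and> prime_colour p = i}"
proof -
  let ?g = "\<lambda>j. from_nat_into {p::nat. prime p} (prod_encode (i, j))"
  have inf: "countable {p::nat. prime p}" "infinite {p::nat. prime p}"
    by (auto simp: primes_infinite)
  have "inj ?g"
    using bij_betw_from_nat_into[OF inf]
    by (auto intro!: injI dest!: bij_betw_imp_inj_on injD)
  then have "infinite (range ?g)" by (rule range_inj_infinite)
  moreover have "range ?g \<subseteq> {p. prime p \<and> prime_colour p = i}"
  proof safe
    fix j
    show "prime (?g j)"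
      using from_nat_into[of "{p::nat. prime p}"] inf(2) by (metis finite.emptyI mem_Collect_eq)
    show "prime_colour (?g j) = i"
      unfolding prime_colour_def by (simp add: to_nat_on_from_nat_into_infinite[OF inf])
  qed
  ultimately show ?thesis using finite_subset by blast
qed

section \<open>Collapsing large prime factors to 2 or 3\<close>

definition collapse_prime :: "nat set \<Rightarrow> nat \<Rightarrow> nat \<Rightarrow> nat" where
  "collapse_prime A N p = (if p < N \<or> p \<le> 3 then p else if prime_colour p \<in> A then 2 else 3)"

definition collapse_nat :: "nat set \<Rightarrow> nat \<Rightarrow> nat \<Rightarrow> nat" where
  "collapse_nat A N n = prod_mset (image_mset (collapse_prime A N) (prime_factorization n))"

lemma prime_collapse_prime: "prime p \<Longrightarrow> prime (collapse_prime A N p)"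
  by (simp add: collapse_prime_def)

lemma prime_factorization_collapse_nat:
  "prime_factorization (collapse_nat A N n) = image_mset (collapse_prime A N) (prime_factorization n)"
  unfolding collapse_nat_def
  by (rule prime_factorization_prod_mset_primes) (auto intro: prime_collapse_prime)

lemma collapse_nat_pos: "collapse_nat A N n > 0"
proof -
  have "collapse_prime A N p \<noteq> 0" if "p \<in># prime_factorization n" for p
    using prime_collapse_prime[of p A N] that by (metis in_prime_factors_imp_prime not_prime_0)
  then have "0 \<notin># image_mset (collapse_prime A N) (prime_factorization n)"
    by force
  then show ?thesis
    unfolding collapse_nat_def by (metis gr0I prod_mset_zero_iff)
qed

lemma collapse_nat_mult:
  "m > 0 \<Longrightarrow> n > 0 \<Longrightarrow> collapse_nat A N (m * n) = collapse_nat A N m * collapse_nat A N n"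
  by (simp add: collapse_nat_def prime_factorization_mult)

lemma collapse_nat_prime: "prime p \<Longrightarrow> collapse_nat A N p = collapse_prime A N p"
  by (simp add: collapse_nat_def prime_factorization_prime)

lemma collapse_nat_collapse_nat:
  "N \<le> M \<Longrightarrow> collapse_nat A N (collapse_nat A M n) = collapse_nat A N n"
  "N \<le> M \<Longrightarrow> collapse_nat A M (collapse_nat A N n) = collapse_nat A N n"
  unfolding collapse_nat_def[of _ _ "collapse_nat _ _ _"] prime_factorization_collapse_nat
  by (auto simp: collapse_nat_def collapse_prime_def multiset.map_comp
      intro!: arg_cong[of _ _ prod_mset] image_mset_cong)

lemma collapse_nat_fixed:
  assumes "n > 0" "N > n"
  shows "collapse_nat A N n = n"
proof -
  have "p < N" if "p \<in># prime_factorization n" for p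
    using that assms by (meson dvd_imp_le in_prime_factors_imp_dvd le_less_trans)
  then have "image_mset (collapse_prime A N) (prime_factorization n) = prime_factorization n"
    by (auto simp: collapse_prime_def intro!: multiset.map_ident_strong)
  then show ?thesis
    using assms by (simp add: collapse_nat_def prod_mset_prime_factorization_nat)
qed

definition small_prime_count :: "nat \<Rightarrow> nat" where
  "small_prime_count n = size (filter_mset (\<lambda>p. p \<le> 3) (prime_factorization n))"

text \<open>A prime is only ever moved from above 3 to 2 or 3. So either no prime factor moves and
  \<open>n\<close> is fixed, or the count goes up.\<close>

lemma small_prime_count_collapse_nat:
  assumes "n > 0" "collapse_nat A N n \<noteq> n"
  shows "small_prime_count n < small_prime_count (collapse_nat A N n)"
proof -
  let ?c = "\<lambda>P. size (filter_mset (\<lambda>p. p \<le> (3::nat)) P)"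
  have "image_mset (collapse_prime A N) P = P \<or> ?c P < ?c (image_mset (collapse_prime A N) P)" for P
    by (induction P) (auto simp: collapse_prime_def)
  then show ?thesis
    using assms unfolding small_prime_count_def prime_factorization_collapse_nat
    by (metis collapse_nat_def prod_mset_prime_factorization_nat)
qed

lemma prod_mset_le_power:
  fixes f :: "nat \<Rightarrow> nat"
  assumes "\<And>p. p \<in># P \<Longrightarrow> p \<le> f p ^ K"
  shows "prod_mset P \<le> prod_mset (image_mset f P) ^ K"
  using assms by (induction P) (auto simp: power_mult_distrib intro!: mult_le_mono)

text \<open>This yields finite fibres on the fixed points of level \<open>M\<close>. Such fixed
  points have bounded prime factors only, and as each factor collapses to a number that is at least
  2, a fixed power of the image dominates it.\<close>

lemma le_power_collapse_nat:
  assumes n: "n > 0" "collapse_nat A M n = n"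
  shows "n \<le> collapse_nat A N n ^ (M + 3)"
proof -
  have "p \<le> collapse_prime A N p ^ (M + 3)" if p: "p \<in># prime_factorization n" for p
  proof -
    have "p \<in># image_mset (collapse_prime A M) (prime_factorization n)"
      using p n(2) prime_factorization_collapse_nat by metis
    then have "p \<le> M + 3" by (auto simp: collapse_prime_def split: if_splits)
    also have "\<dots> \<le> 2 ^ (M + 3)" using less_exp by (rule less_imp_le)
    also have "\<dots> \<le> collapse_prime A N p ^ (M + 3)"
      using p by (intro power_mono prime_ge_2_nat prime_collapse_prime in_prime_factors_imp_prime) auto
    finally show ?thesis .
  qed
  from prod_mset_le_power[of "prime_factorization n", OF this] show ?thesis
    using n(1) by (simp add: collapse_nat_def prod_mset_prime_factorization_nat)
qed

section \<open>The retractions on \<open>pnat\<close>, and distinctness of the resulting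
  spaces\<close>

lift_definition collapse :: "nat set \<Rightarrow> nat \<Rightarrow> pnat \<Rightarrow> pnat" is collapse_nat
  by (rule collapse_nat_pos)

lemma inj_nat_of_pnat: "inj nat_of_pnat"
  by (rule injI) (simp add: nat_of_pnat_inject)

interpretation collapse: semigroup_retractions "collapse A" "\<lambda>s. small_prime_count (nat_of_pnat s)" for A
proof
  fix N M :: nat and s t m :: pnat
  show "collapse A N (collapse A M s) = collapse A N s" if "N \<le> M"
    using that by transfer (rule collapse_nat_collapse_nat)
  show "collapse A M (collapse A N s) = collapse A N s" if "N \<le> M"
    using that by transfer (rule collapse_nat_collapse_nat)
  have "collapse A N s = s" if "N > nat_of_pnat s" for N
    using that by transfer (rule collapse_nat_fixed)
  then show "\<forall>\<^sub>F N in sequentially. collapse A N s = s"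
    using eventually_gt_at_top[of "nat_of_pnat s"] by (rule eventually_mono[rotated])
  show "small_prime_count (nat_of_pnat s) < small_prime_count (nat_of_pnat (collapse A N s))"
    if "collapse A N s \<noteq> s"
    using that by transfer (rule small_prime_count_collapse_nat)
  show "finite {s. collapse A M s = s \<and> collapse A N s = m}"
  proof (rule finite_subset)
    have "nat_of_pnat s \<le> nat_of_pnat (collapse A N s) ^ (M + 3)" if "collapse A M s = s" for s
      using that by transfer (rule le_power_collapse_nat)
    then show "{s. collapse A M s = s \<and> collapse A N s = m} \<subseteq> nat_of_pnat -` {..nat_of_pnat m ^ (M + 3)}"
      by auto
    show "finite (nat_of_pnat -` {..nat_of_pnat m ^ (M + 3)})"
      by (intro finite_vimageI inj_nat_of_pnat) simp
  qed
  show "collapse A N (s * t) = collapse A N s * collapse A N t"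
    by transfer (rule collapse_nat_mult)
  show "inj ((*) s)"
    by (rule injI, transfer) simp
qed

text \<open>The primes of a colour in \<open>A\<close> tend to \<open>2\<close> in the topology of \<open>retract_space (collapse A)\<close>, and
  the others tend to \<open>3\<close>.\<close>

lemma retract_space_collapse_neq:
  assumes i: "i \<in> A" "i \<notin> B"
  shows "retract_space (collapse A) \<noteq> retract_space (collapse B)"
proof
  assume eq: "retract_space (collapse A) = retract_space (collapse B)"
  let ?f = "\<lambda>s. unit_vec (pnat_of_nat 2) (collapse A 0 s)"
  have "?f \<in> retract_space (collapse B)"
    using collapse.unit_vec_retract eq by metis
  then obtain M where M: "\<And>s. norm (?f (collapse B M s) - ?f s) < 1"
    using collapse.retract_space_near[of ?f B 1] by auto
  \<comment> \<open>Beyond both \<open>M\<close> and 3, this prime is collapsed to 2 for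
    \<open>A\<close> but to 3 for \<open>B\<close>. So \<open>?f\<close> is 1 at \<open>p\<close>
    and 0 at its image under \<open>collapse B M\<close>.\<close>
  obtain p where p: "prime p" "prime_colour p = i" "p > max M 3"
    using infinite_prime_colour[of i] unfolding infinite_nat_iff_unbounded by blast
  have col: "collapse A' N (pnat_of_nat q) = pnat_of_nat (collapse_prime A' N q)" if "prime q" for A' N q
    using that by (simp add: collapse.abs_eq eq_onp_def prime_gt_0_nat collapse_nat_prime)
  have "collapse A 0 (pnat_of_nat p) = pnat_of_nat 2" "collapse B M (pnat_of_nat p) = pnat_of_nat 3"
    "collapse A 0 (pnat_of_nat 3) = pnat_of_nat 3"
    using p i by (simp_all add: col collapse_prime_def)
  moreover have "pnat_of_nat 3 \<noteq> pnat_of_nat 2"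
    by (simp add: pnat_of_nat_inject)
  ultimately show False
    using M[of "pnat_of_nat p"] by (simp add: unit_vec_def)
qed

theorem theorem3p8:
  shows "\<exists>\<F> :: (pnat \<Rightarrow> complex) set set.
    \<F> \<approx> (UNIV :: nat set set) \<and> (\<forall>E\<in>\<F>. hopf_algebra_predual E)"
proof (intro exI conjI)
  let ?E = "\<lambda>A. retract_space (collapse A)"
  have "inj ?E"
    \<comment> \<open>Of two different sets of colours, one contains a colour missing from the
      other.\<close>
    by (rule injI) (metis retract_space_collapse_neq subsetI subset_antisym)
  then show "range ?E \<approx> (UNIV :: nat set set)"
    by (rule inj_on_image_eqpoll_self)
  show "\<forall>E\<in>range ?E. hopf_algebra_predual E"
    by (auto intro: collapse.hopf_algebra_predual_retract_space)
qed

end
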